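(* Let $\mathrm{a}_{n,k}^{\mathrm{asc}}(132,321)$ (respectively $\mathrm{a}_{n,k}^{\mathrm{des}}(132,321)$) denote the number of permutations of $\{1,\dots,n\}$ that avoid both $132$ and $321$ and have exactly $k$ ascents (respectively $k$ descents). Then for all integers $n\ge1$ and $k\ge0$, $$\mathrm{a}_{n,k}^{\mathrm{asc}}(132,321)=\begin{cases}1,&k=n-1;\\ \binom{n}{2},&k=n-2;\\ 0,&\text{otherwise},\end{cases}$$ and $$\mathrm{a}_{n,k}^{\mathrm{des}}(132,321)=\begin{cases}1,&k=0;\\ \binom{n}{2},&k=1;\\ 0,&\text{otherwise}.\end{cases}$$
   Context: $\mathcal{S}_n$ is the set of permutations $\pi=\pi_1\cdots\pi_n$ of $\{1,\dots,n\}$. For $\rho\in\mathcal{S}_m$, $\pi\in\mathcal{S}_n$ contains $\rho$ if there are indices $1\le i_1<\cdots<i_m\le n$ such that $\pi_{i_a}<\pi_{i_b}$ if and only if $\rho_a<\rho_b$; otherwise $\pi$ avoids $\rho$. The number of ascents is $\mathrm{asc}(\pi)=|\{i:\pi_i<\pi_{i+1}\}|$ and the number of descents is $\mathrm{des}(\pi)=|\{i:\pi_i>\pi_{i+1}\}|$, where $1\le i\le n-1$. *)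

theory Defs
  imports "HOL-Combinatorics.Multiset_Permutations"
begin

text \<open>Permutations are in one-line notation: \<open>\<pi>\<^sub>1 \<dots> \<pi>\<^sub>n\<close> is the list \<open>[\<pi>\<^sub>1, \<dots>, \<pi>\<^sub>n]\<close>, so the
  entries are \<open>1, \<dots>, n\<close> while positions are counted from 0, as usual for lists.\<close>

definition perms :: "nat \<Rightarrow> nat list set" where
  "perms n = permutations_of_set {1..n}"

definition contains :: "nat list \<Rightarrow> nat list \<Rightarrow> bool" where
  "contains \<pi> \<rho> \<longleftrightarrow>
     (\<exists>i :: nat \<Rightarrow> nat. strict_mono_on {..<length \<rho>} i \<and> i ` {..<length \<rho>} \<subseteq> {..<length \<pi>} \<and>
        (\<forall>a<length \<rho>. \<forall>b<length \<rho>. \<pi> ! i a < \<pi> ! i b \<longleftrightarrow> \<rho> ! a < \<rho> ! b))"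

abbreviation avoids :: "nat list \<Rightarrow> nat list \<Rightarrow> bool" where
  "avoids \<pi> \<rho> \<equiv> \<not> contains \<pi> \<rho>"

definition asc :: "nat list \<Rightarrow> nat" where
  "asc \<pi> = card {i. Suc i < length \<pi> \<and> \<pi> ! i < \<pi> ! Suc i}"

definition des :: "nat list \<Rightarrow> nat" where
  "des \<pi> = card {i. Suc i < length \<pi> \<and> \<pi> ! i > \<pi> ! Suc i}"

definition a_asc :: "nat \<Rightarrow> nat \<Rightarrow> nat list \<Rightarrow> nat list \<Rightarrow> nat" where
  "a_asc n k \<rho> \<sigma> = card {\<pi> \<in> perms n. avoids \<pi> \<rho> \<and> avoids \<pi> \<sigma> \<and> asc \<pi> = k}"

definition a_des :: "nat \<Rightarrow> nat \<Rightarrow> nat list \<Rightarrow> nat list \<Rightarrow> nat" where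
  "a_des n k \<rho> \<sigma> = card {\<pi> \<in> perms n. avoids \<pi> \<rho> \<and> avoids \<pi> \<sigma> \<and> des \<pi> = k}"

end

theory Submission
  imports Defs "HOL-Library.Sublist"
begin

text \<open>Split a permutation of \<open>1, \<dots>, n + 1\<close> at its maximum as \<open>L (n+1) R\<close>. Avoiding 132 forces
  every entry of \<open>L\<close> to exceed every entry of \<open>R\<close>, and avoiding 321 forces \<open>R\<close> to increase. If
  \<open>R\<close> is nonempty, avoiding 321 also forces \<open>L\<close> to increase, so the permutation is
  \<open>(a+1) \<dots> (n+1) 1 \<dots> a\<close> for some \<open>1 \<le> a \<le> n\<close>, with exactly one descent. If \<open>R\<close> is empty,
  deleting the maximum is a descent-preserving bijection onto the avoiders of length \<open>n\<close>. Hence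
  going from \<open>n\<close> to \<open>n + 1\<close> adds exactly \<open>n\<close> avoiders, each with one descent. Ascents and
  descents are complementary in number.\<close>

section \<open>Pattern containment in terms of subsequences\<close>

lemma subseq_set_mono: "subseq xs ys \<Longrightarrow> set xs \<subseteq> set ys"
  by (induction rule: list_emb.induct) auto

lemma subseq_upt:
  assumes "sorted_wrt (<) is" "set is \<subseteq> {..<n}"
  shows "subseq is [0..<n]"
proof -
  \<comment> \<open>A strictly increasing list is determined by its set, so \<open>is\<close> is a
    filter of \<open>[0..<n]\<close>.\<close>
  have "is = sorted_list_of_set (set is)"
    using assms(1) sorted_list_of_set.idem_if_sorted_distinct strict_sorted_iff by metis
  also have "\<dots> = filter (\<lambda>i. i \<in> set is) [0..<n]"
  proof (rule sorted_distinct_set_unique)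
    show "set (sorted_list_of_set (set is)) = set (filter (\<lambda>i. i \<in> set is) [0..<n])"
      using assms(2) by auto
  qed (auto simp: sorted_wrt_filter)
  finally show ?thesis
    by (metis subseq_filter_left)
qed

text \<open>Bridge from the index embeddings in \<open>contains\<close> to the inductive
  \<open>subseq\<close>, which splits along \<open>@\<close>. Conversely, an increasing index list
  is a subsequence of \<open>[0..<length \<pi>]\<close>, and looking up entries of
  \<open>\<pi>\<close> preserves this.\<close>

lemma subseq_iff_indices:
  "subseq \<sigma> \<pi> \<longleftrightarrow> (\<exists>i. strict_mono_on {..<length \<sigma>} i \<and> i ` {..<length \<sigma>} \<subseteq> {..<length \<pi>} \<and>
     (\<forall>a<length \<sigma>. \<pi> ! i a = \<sigma> ! a))" (is "_ \<longleftrightarrow> (\<exists>i. ?P \<sigma> \<pi> i)")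
proof
  assume "subseq \<sigma> \<pi>"
  then show "\<exists>i. ?P \<sigma> \<pi> i"
  proof (induction rule: list_emb.induct)
    case (list_emb_Nil ys)
    then show ?case by (auto simp: strict_mono_on_def)
  next
    case (list_emb_Cons xs ys y)
    then obtain i where "?P xs ys i" by blast
    then have "?P xs (y # ys) (\<lambda>a. Suc (i a))"
      by (auto simp: strict_mono_on_def image_subset_iff)
    then show ?case by blast
  next
    case (list_emb_Cons2 x y xs ys)
    then obtain i where "?P xs ys i" by blast
    \<comment> \<open>The matched head goes to position 0; all other positions shift by one.\<close>
    with list_emb_Cons2.hyps have "?P (x # xs) (y # ys) (case_nat 0 (\<lambda>a. Suc (i a)))"
      by (auto simp: strict_mono_on_def image_subset_iff nth_Cons split: nat.splits)
    then show ?case by blast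
  qed
next
  assume "\<exists>i. ?P \<sigma> \<pi> i"
  then obtain i where i: "?P \<sigma> \<pi> i" by blast
  have "subseq (map i [0..<length \<sigma>]) [0..<length \<pi>]"
    using i by (intro subseq_upt)
      (auto simp: sorted_wrt_iff_nth_less strict_mono_on_def image_subset_iff)
  then have "subseq (map ((!) \<pi>) (map i [0..<length \<sigma>])) (map ((!) \<pi>) [0..<length \<pi>])"
    by (rule subseq_map)
  moreover have "map ((!) \<pi>) (map i [0..<length \<sigma>]) = \<sigma>"
    using i by (auto intro: nth_equalityI)
  ultimately show "subseq \<sigma> \<pi>"
    by (simp add: map_nth)
qed

lemma contains_iff_subseq:
  "contains \<pi> \<rho> \<longleftrightarrow> (\<exists>\<sigma>. subseq \<sigma> \<pi> \<and> length \<sigma> = length \<rho> \<and>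
     (\<forall>a<length \<rho>. \<forall>b<length \<rho>. \<sigma> ! a < \<sigma> ! b \<longleftrightarrow> \<rho> ! a < \<rho> ! b))" (is "_ = ?R")
proof
  assume "contains \<pi> \<rho>"
  then obtain i where i: "strict_mono_on {..<length \<rho>} i" "i ` {..<length \<rho>} \<subseteq> {..<length \<pi>}"
    "\<forall>a<length \<rho>. \<forall>b<length \<rho>. \<pi> ! i a < \<pi> ! i b \<longleftrightarrow> \<rho> ! a < \<rho> ! b"
    unfolding contains_def by blast
  let ?\<sigma> = "map (\<lambda>a. \<pi> ! i a) [0..<length \<rho>]"
  have "subseq ?\<sigma> \<pi>"
    unfolding subseq_iff_indices using i by (intro exI[of _ i]) auto
  with i(3) show ?R
    by (intro exI[of _ ?\<sigma>]) auto
next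
  assume ?R
  then show "contains \<pi> \<rho>"
    unfolding contains_def subseq_iff_indices by (metis (no_types, lifting))
qed

lemma ex_list_length_3: "(\<exists>\<sigma>. length \<sigma> = 3 \<and> P \<sigma>) \<longleftrightarrow> (\<exists>x y z. P [x, y, z])"
proof
  assume "\<exists>x y z. P [x, y, z]"
  then obtain x y z where "P [x, y, z]" by blast
  then show "\<exists>\<sigma>. length \<sigma> = 3 \<and> P \<sigma>" by (intro exI[of _ "[x, y, z]"]) simp
qed (auto simp: numeral_3_eq_3 length_Suc_conv)

text \<open>The chain \<open>x < z < y\<close> settles all nine comparisons that containment asks
  for.\<close>

lemma contains_132_iff:
  "contains \<pi> [1, 3, 2] \<longleftrightarrow> (\<exists>x y z. subseq [x, y, z] \<pi> \<and> x < z \<and> z < y)"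
proof -
  have "contains \<pi> [1, 3, 2] \<longleftrightarrow> (\<exists>\<sigma>. length \<sigma> = 3 \<and> subseq \<sigma> \<pi> \<and>
      (\<forall>a<3. \<forall>b<3. \<sigma> ! a < \<sigma> ! b \<longleftrightarrow> [1, 3, 2::nat] ! a < [1, 3, 2] ! b))"
    unfolding contains_iff_subseq by (simp add: numeral_3_eq_3 conj_commute conj_left_commute)
  then show ?thesis
    unfolding ex_list_length_3 by (simp add: numeral_3_eq_3 All_less_Suc2)
      (meson less_trans not_less_iff_gr_or_eq)
qed

lemma contains_321_iff:
  "contains \<pi> [3, 2, 1] \<longleftrightarrow> (\<exists>x y z. subseq [x, y, z] \<pi> \<and> x > y \<and> y > z)"
proof -
  have "contains \<pi> [3, 2, 1] \<longleftrightarrow> (\<exists>\<sigma>. length \<sigma> = 3 \<and> subseq \<sigma> \<pi> \<and>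
      (\<forall>a<3. \<forall>b<3. \<sigma> ! a < \<sigma> ! b \<longleftrightarrow> [3, 2, 1::nat] ! a < [3, 2, 1] ! b))"
    unfolding contains_iff_subseq by (simp add: numeral_3_eq_3 conj_commute conj_left_commute)
  then show ?thesis
    unfolding ex_list_length_3 by (simp add: numeral_3_eq_3 All_less_Suc2)
      (meson less_trans not_less_iff_gr_or_eq)
qed

text \<open>Turns the absence of patterns into sortedness, and lets sortedness pass to subsequences
  by transitivity of \<open>subseq\<close>.\<close>

lemma sorted_wrt_iff_subseq: "sorted_wrt P xs \<longleftrightarrow> (\<forall>x y. subseq [x, y] xs \<longrightarrow> P x y)"
proof (induction xs)
  case (Cons a xs)
  have "subseq [x, y] (a # xs) \<longleftrightarrow> x = a \<and> y \<in> set xs \<or> subseq [x, y] xs" for x y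
    by (auto dest: subseq_Cons' simp: subseq_singleton_left)
  then show ?case
    using Cons.IH by auto
qed simp

text \<open>The four cases count how many of the letters fall in \<open>us\<close>: three, two, one
  or none.\<close>

lemma subseq3_append:
  "subseq [x, y, z] (us @ vs) \<longleftrightarrow> subseq [x, y, z] us \<or> subseq [x, y] us \<and> z \<in> set vs \<or>
     x \<in> set us \<and> subseq [y, z] vs \<or> subseq [x, y, z] vs"
  unfolding subseq_append_iff
  by (simp add: Cons_eq_append_conv subseq_singleton_left conj_disj_distribL conj_disj_distribR
      ex_disj_distrib) blast

section \<open>The avoiders and their recursive structure\<close>

definition Av :: "nat \<Rightarrow> nat list set" where
  "Av n = {\<pi> \<in> perms n. avoids \<pi> [1, 3, 2] \<and> avoids \<pi> [3, 2, 1]}"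

text \<open>For \<open>a \<le> n\<close>, the identity permutation rotated left by \<open>a\<close>
  places.\<close>

definition rot :: "nat \<Rightarrow> nat \<Rightarrow> nat list" where
  "rot n a = [Suc a..<Suc n] @ [1..<Suc a]"

lemma in_perms_iff: "\<pi> \<in> perms n \<longleftrightarrow> set \<pi> = {1..n} \<and> distinct \<pi>"
  by (auto simp: perms_def permutations_of_set_def)

lemma length_perms: "\<pi> \<in> perms n \<Longrightarrow> length \<pi> = n"
  using distinct_card[of \<pi>] by (simp add: in_perms_iff)

lemma finite_Av: "finite (Av n)"
  by (simp add: Av_def perms_def)

text \<open>A final maximum could only be the last letter of an occurrence, but both patterns end
  with a letter below its predecessor.\<close>

lemma append_max_in_Av_iff: "l @ [Suc n] \<in> Av (Suc n) \<longleftrightarrow> l \<in> Av n"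
proof -
  have p: "l @ [Suc n] \<in> perms (Suc n) \<longleftrightarrow> l \<in> perms n"
    unfolding in_perms_iff by (simp add: atLeastAtMostSuc_conv) (auto simp: insert_ident)
  have e: "subseq [x, y, z] (l @ [Suc n]) \<longleftrightarrow> subseq [x, y, z] l \<or> subseq [x, y] l \<and> z = Suc n"
    for x y z
    by (auto simp: subseq3_append)
  show ?thesis
  proof (cases "l \<in> perms n")
    case True
    have le: "x \<le> n \<and> y \<le> n" if "subseq [x, y] l" for x y
      using subseq_set_mono[OF that] True by (auto simp: in_perms_iff)
    have "contains (l @ [Suc n]) [1, 3, 2] \<longleftrightarrow> contains l [1, 3, 2]"
      "contains (l @ [Suc n]) [3, 2, 1] \<longleftrightarrow> contains l [3, 2, 1]"
      unfolding contains_132_iff contains_321_iff e by (auto dest: le)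
    then show ?thesis
      using p by (simp only: Av_def mem_Collect_eq)
  qed (use p in \<open>simp add: Av_def\<close>)
qed

text \<open>Both blocks increase, so a descent \<open>y > z\<close> has \<open>y\<close> in the
  first block and \<open>z\<close> in the second. A letter before \<open>y\<close> is then also in
  the first block, hence below \<open>y\<close> and above \<open>z\<close>, which excludes both
  patterns.\<close>

lemma rot_in_Av:
  assumes "a \<le> n"
  shows "rot n a \<in> Av n"
proof -
  have sorted: "sorted_wrt (<) xs \<and> set xs \<subseteq> {i..<j}" if "subseq xs [i..<j]" for xs i j
    using that sorted_wrt_upt[of i j] subseq_set_mono[OF that]
    unfolding sorted_wrt_iff_subseq by (auto dest: subseq_order.trans)
  have "avoids (rot n a) [1, 3, 2]" "avoids (rot n a) [3, 2, 1]"
    unfolding contains_132_iff contains_321_iff rot_def subseq3_append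
    by (auto dest!: sorted simp del: upt_Suc)
  with assms show ?thesis
    by (auto simp: Av_def in_perms_iff rot_def)
qed

lemma Av_cases:
  assumes "\<pi> \<in> Av (Suc n)"
  obtains l where "\<pi> = l @ [Suc n]" | a where "1 \<le> a" "a \<le> n" "\<pi> = rot (Suc n) a"
proof -
  have set: "set \<pi> = {1..Suc n}" and dist: "distinct \<pi>"
    using assms by (simp_all add: Av_def in_perms_iff)
  have no132: "\<not> z < y" if "subseq [x, y, z] \<pi>" "x < z" for x y z
    using assms that unfolding Av_def contains_132_iff by blast
  have no321: "\<not> z < y" if "subseq [x, y, z] \<pi>" "y < x" for x y z
    using assms that unfolding Av_def contains_321_iff by blast
  obtain L R where \<pi>: "\<pi> = L @ Suc n # R"
    using set split_list[of "Suc n" \<pi>] by auto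
  have LR: "set L \<union> set R = {1..n}"
  proof -
    have "insert (Suc n) (set L \<union> set R) = insert (Suc n) {1..n}"
      using set unfolding \<pi> by (simp add: atLeastAtMostSuc_conv)
    moreover have "Suc n \<notin> set L \<union> set R"
      using dist unfolding \<pi> by simp
    ultimately show ?thesis
      by (simp add: insert_ident)
  qed
  have gt: "z < x" if "x \<in> set L" "z \<in> set R" for x z
  proof -
    have "subseq [x, Suc n, z] \<pi>"
      using that unfolding \<pi> subseq3_append by (simp add: subseq_singleton_left)
    moreover have "z \<in> {1..n}" using that LR by blast
    moreover have "x \<noteq> z" using that dist unfolding \<pi> by auto
    ultimately show ?thesis using no132[of x "Suc n" z] by force
  qed
  show thesis
  proof (cases "R = []")
    case True
    then show thesis using that(1) \<pi> by simp
  next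
    case False
    have "sorted_wrt (\<le>) R"
      unfolding sorted_wrt_iff_subseq
    proof (intro allI impI)
      fix x y assume xy: "subseq [x, y] R"
      then have "subseq [Suc n, x, y] \<pi>" unfolding \<pi> subseq3_append by simp
      moreover have "x \<in> {1..n}" using subseq_set_mono[OF xy] LR by auto
      ultimately show "x \<le> y" using no321[of "Suc n" x y] by force
    qed
    moreover have "sorted_wrt (\<le>) L"
      unfolding sorted_wrt_iff_subseq
    proof (intro allI impI)
      fix x y assume xy: "subseq [x, y] L"
      \<comment> \<open>Any \<open>r\<close> in \<open>R\<close> lies below all of \<open>L\<close>,
        so it would complete a descent in \<open>L\<close> to a 321.\<close>
      obtain r where r: "r \<in> set R" using False by (cases R) auto
      have "subseq [x, y, r] \<pi>" using xy r unfolding \<pi> subseq3_append by simp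
      moreover have "r < y" using subseq_set_mono[OF xy] r gt by auto
      ultimately show "x \<le> y" using no321[of x y r] by linarith
    qed
    ultimately have "sorted (R @ L)"
      using gt by (auto simp: sorted_append less_imp_le)
    moreover have "distinct (R @ L)"
      using dist unfolding \<pi> by auto
    moreover have "set (R @ L) = set [1..<Suc n]"
      using LR by (simp add: Un_commute atLeastLessThanSuc_atLeastAtMost del: upt_Suc)
    \<comment> \<open>Now \<open>R\<close> and \<open>L\<close> are the two pieces of
      \<open>1, ..., n\<close>, fixed by the length of \<open>R\<close> alone.\<close>
    ultimately have RL: "R @ L = [1..<Suc n]"
      by (intro sorted_distinct_set_unique) (simp_all del: upt_Suc)
    define a where "a = length R"
    have a: "1 \<le> a" "a \<le> n"
      using False arg_cong[OF RL, of length] by (auto simp: a_def Suc_le_eq simp del: upt_Suc)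
    have "R = take a [1..<Suc n]" "L = drop a [1..<Suc n]"
      using append_eq_conv_conj[THEN iffD1, OF RL] unfolding a_def by blast+
    then have "R = [1..<Suc a]" "L = [Suc a..<Suc n]"
      using a by (simp_all add: take_upt del: upt_Suc)
    then have "\<pi> = rot (Suc n) a"
      unfolding \<pi> rot_def using a by simp
    then show thesis
      using that(2) a by blast
  qed
qed

lemma Av_Suc: "Av (Suc n) = (\<lambda>l. l @ [Suc n]) ` Av n \<union> rot (Suc n) ` {1..n}"
proof (intro equalityI subsetI)
  fix \<pi> assume \<pi>: "\<pi> \<in> Av (Suc n)"
  then show "\<pi> \<in> (\<lambda>l. l @ [Suc n]) ` Av n \<union> rot (Suc n) ` {1..n}"
    by (cases rule: Av_cases) (use \<pi> in \<open>auto simp: append_max_in_Av_iff\<close>)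
qed (auto simp: append_max_in_Av_iff rot_in_Av)

section \<open>Counting avoiders by descents\<close>

lemma last_rot: "1 \<le> a \<Longrightarrow> last (rot n a) = a"
  by (simp add: rot_def)

lemma des_append_max: "\<forall>x\<in>set l. x \<le> m \<Longrightarrow> des (l @ [m]) = des l"
  unfolding des_def
  by (intro arg_cong[where f = card] Collect_cong)
    (auto simp: nth_append less_Suc_eq leD)

lemma des_rot:
  assumes "1 \<le> a" "a < n"
  shows "des (rot n a) = 1"
proof -
  \<comment> \<open>The first block has length \<open>n - a\<close>, so with positions from 0 its
    last entry is at \<open>n - a - 1\<close>. Both blocks are nonempty.\<close>
  have "{i. Suc i < length (rot n a) \<and> rot n a ! i > rot n a ! Suc i} = {n - a - 1}"
    using assms by (auto simp: rot_def nth_append simp del: upt_Suc split: if_splits)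
  then show ?thesis
    by (simp add: des_def)
qed

lemma card_Av_des:
  "card {\<pi> \<in> Av n. des \<pi> = k} = (if k = 0 then 1 else if k = 1 then n choose 2 else 0)"
proof (induction n)
  case 0
  have "perms 0 = {[]}"
    by (simp add: perms_def)
  moreover have "avoids [] [1, 3, 2]" "avoids [] [3, 2, 1]"
    unfolding contains_132_iff contains_321_iff by simp_all
  ultimately have "\<pi> \<in> Av 0 \<longleftrightarrow> \<pi> = []" for \<pi>
    unfolding Av_def by blast
  moreover have "des [] = 0"
    by (simp add: des_def)
  ultimately have "{\<pi> \<in> Av 0. des \<pi> = k} = (if k = 0 then {[]} else {})"
    by (simp add: set_eq_iff) metis
  then show ?case by simp
next
  case (Suc n)
  let ?A = "(\<lambda>l. l @ [Suc n]) ` {l \<in> Av n. des l = k}"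
  let ?B = "if k = 1 then rot (Suc n) ` {1..n} else {}"
  have "des (l @ [Suc n]) = des l" if "l \<in> Av n" for l
    using that by (intro des_append_max) (auto simp: Av_def in_perms_iff)
  then have "{\<pi> \<in> Av (Suc n). des \<pi> = k} = ?A \<union> ?B"
    unfolding Av_Suc by (auto simp: des_rot)
  \<comment> \<open>The last entry separates the two families: \<open>n + 1\<close> against some
    \<open>a \<le> n\<close>. Below it also recovers \<open>a\<close> from the rotation.\<close>
  moreover have "l @ [Suc n] \<noteq> rot (Suc n) a" if "a \<in> {1..n}" for l a
    using that last_rot[of a "Suc n"] by (metis Suc_n_not_le_n atLeastAtMost_iff last_snoc)
  then have "?A \<inter> ?B = {}"
    by (split if_split) blast
  moreover have "card ?A = card {l \<in> Av n. des l = k}"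
    by (intro card_image inj_onI) simp
  moreover have "inj_on (rot (Suc n)) {1..n}"
    by (intro inj_on_inverseI[where g = last]) (simp add: last_rot)
  then have "card ?B = (if k = 1 then n else 0)"
    by (simp add: card_image)
  ultimately have "card {\<pi> \<in> Av (Suc n). des \<pi> = k} =
      card {l \<in> Av n. des l = k} + (if k = 1 then n else 0)"
    using finite_Av[of n] by (simp add: card_Un_disjoint)
  \<comment> \<open>For \<open>k = 1\<close> this is Pascal's rule: \<open>n choose 2\<close> plus
    \<open>n\<close> is \<open>Suc n choose 2\<close>.\<close>
  then show ?case
    using Suc.IH by (simp add: numeral_2_eq_2)
qed

section \<open>From descents to ascents\<close>

lemma asc_plus_des:
  assumes "distinct \<pi>"
  shows "asc \<pi> + des \<pi> = length \<pi> - 1"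
proof -
  let ?A = "{i. Suc i < length \<pi> \<and> \<pi> ! i < \<pi> ! Suc i}"
  let ?D = "{i. Suc i < length \<pi> \<and> \<pi> ! i > \<pi> ! Suc i}"
  \<comment> \<open>Distinctness rules out ties between neighbours.\<close>
  have "\<pi> ! i < \<pi> ! Suc i \<or> \<pi> ! i > \<pi> ! Suc i" if "Suc i < length \<pi>" for i
    using assms that by (simp add: nth_eq_iff_index_eq flip: linorder_neq_iff)
  then have "?A \<union> ?D = {i. Suc i < length \<pi>}"
    by blast
  also have "\<dots> = {..<length \<pi> - 1}"
    by auto
  finally have Un: "?A \<union> ?D = {..<length \<pi> - 1}" .
  have "finite (?A \<union> ?D)"
    unfolding Un by simp
  then have "card (?A \<union> ?D) = card ?A + card ?D"
    unfolding finite_Un by (intro card_Un_disjoint) auto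
  with Un show ?thesis
    by (simp add: asc_def des_def)
qed

theorem proposition21:
  fixes n k :: nat
  assumes "n \<ge> 1"
  shows "a_asc n k [1, 3, 2] [3, 2, 1] =
           (if int k = int n - 1 then 1 else if int k = int n - 2 then n choose 2 else 0) \<and>
         a_des n k [1, 3, 2] [3, 2, 1] =
           (if k = 0 then 1 else if k = 1 then n choose 2 else 0)"
proof
  have des_eq: "a_des n j [1, 3, 2] [3, 2, 1] = card {\<pi> \<in> Av n. des \<pi> = j}" for j
    unfolding a_des_def Av_def by (intro arg_cong[where f = card]) auto
  have "asc \<pi> + des \<pi> = n - 1" if "\<pi> \<in> Av n" for \<pi>
    using that asc_plus_des[of \<pi>] length_perms[of \<pi> n] by (simp add: Av_def in_perms_iff)
  \<comment> \<open>The guard \<open>k \<le> n - 1\<close> matters: for larger \<open>k\<close>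
    truncated subtraction would give \<open>des \<pi> = 0\<close>.\<close>
  then have "asc \<pi> = k \<longleftrightarrow> k \<le> n - 1 \<and> des \<pi> = n - 1 - k" if "\<pi> \<in> Av n" for \<pi>
    using that by fastforce
  then have "{\<pi> \<in> Av n. asc \<pi> = k} = (if k \<le> n - 1 then {\<pi> \<in> Av n. des \<pi> = n - 1 - k} else {})"
    by auto
  moreover have "a_asc n k [1, 3, 2] [3, 2, 1] = card {\<pi> \<in> Av n. asc \<pi> = k}"
    unfolding a_asc_def Av_def by (intro arg_cong[where f = card]) auto
  ultimately show "a_asc n k [1, 3, 2] [3, 2, 1] =
      (if int k = int n - 1 then 1 else if int k = int n - 2 then n choose 2 else 0)"
    \<comment> \<open>Since \<open>n \<ge> 1\<close>, the natural number \<open>n - 1\<close> agrees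
      with \<open>int n - 1\<close>.\<close>
    using assms by (auto simp: card_Av_des)
  show "a_des n k [1, 3, 2] [3, 2, 1] = (if k = 0 then 1 else if k = 1 then n choose 2 else 0)"
    by (simp only: des_eq card_Av_des)
qed

end
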